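(* Let $m \geq 3$ and $s > 1$ be integers. Then the generalized helm graph $H(m,s)$ satisfies $\mathrm{Z}\big(H(m,s)\big) = m(s-1)+1$ and $\mathrm{pt}\big(H(m,s)\big) = 2$.
   Context: The generalized helm graph $H(m,s)$ is the (simple, undirected) graph with vertex set $\{v_i\}_{0 \le i \le m} \cup \{p_{i,j}\}_{1\le i\le m,\ 1 \le j \le s}$ whose edges are: $v_0v_i$ for $1\le i\le m$; $v_{i_1}v_{i_2}$ for $i_1,i_2\in\{1,\dots,m\}$ with $|i_1-i_2|=1$ or $\{i_1,i_2\}=\{1,m\}$; and $v_ip_{i,j}$ for $1\le i\le m$ and $1\le j\le s$. That is, it is the wheel with center $v_0$ and $m$ spoke vertices, with $s$ pendant vertices attached to each spoke vertex. Zero forcing: each vertex of a graph $G$ is initially colored blue or white. Color change rule: if $u$ is blue and $v$ is the only white neighbor of $u$, then $u$ can force $v$ to become blue; blue vertices stay blue. A set $B \subseteq V(G)$ is a zero forcing set of $G$ if, starting with exactly the vertices of $B$ blue, repeated application of the rule eventually makes every vertex blue. The zero forcing number $\mathrm{Z}(G)$ is the minimum cardinality of a zero forcing set of $G$. Propagation time: for a zero forcing set $B$ let $B^{[0]} = B$ and, for $k \geq 1$, let $B^{[k]} = B^{[k-1]} \cup B^{(k)}$, where $B^{(k)}$ is the set of all white vertices that can be forced by the color change rule when $B^{[k-1]}$ is exactly the set of blue vertices (all possible forces are performed simultaneously in each time-step). Then $\mathrm{pt}(G,B)$ is the least $k$ with $B^{[k]} = V(G)$, and $\mathrm{pt}(G)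 = \min\{\mathrm{pt}(G,B) : B \text{ is a zero forcing set of } G \text{ with } |B| = \mathrm{Z}(G)\}$. *)

theory Defs
  imports Main
begin

record 'a graph =
  verts :: "'a set"
  edges :: "'a set set"

definition finite_simple_graph :: "'a graph \<Rightarrow> bool" where
  "finite_simple_graph G \<longleftrightarrow>
     finite (verts G) \<and> (\<forall>e\<in>edges G. e \<subseteq> verts G \<and> card e = 2)"

definition neighbors :: "'a graph \<Rightarrow> 'a \<Rightarrow> 'a set" where
  "neighbors G u = {v \<in> verts G. {u, v} \<in> edges G}"

text \<open>In the following, \<open>S\<close> is the set of vertices that are currently blue; the other
  vertices are white.\<close>

definition can_force :: "'a graph \<Rightarrow> 'a set \<Rightarrow> 'a \<Rightarrow> 'a \<Rightarrow> bool" where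
  "can_force G S u v \<longleftrightarrow> u \<in> S \<and> neighbors G u - S = {v}"

inductive force_step :: "'a graph \<Rightarrow> 'a set \<Rightarrow> 'a set \<Rightarrow> bool" for G where
  "can_force G S u v \<Longrightarrow> force_step G S (insert v S)"

definition zero_forcing_set :: "'a graph \<Rightarrow> 'a set \<Rightarrow> bool" where
  "zero_forcing_set G B \<longleftrightarrow> B \<subseteq> verts G \<and> (force_step G)\<^sup>*\<^sup>* B (verts G)"

text \<open>The minima below are taken over nonempty sets of naturals whenever \<open>G\<close> is finite:
  \<open>verts G\<close> is a zero forcing set, and the simultaneous process started in a zero forcing
  set reaches \<open>verts G\<close> after finitely many steps.\<close>

definition zero_forcing_number :: "'a graph \<Rightarrow> nat" where
  "zero_forcing_number G = (LEAST n. \<exists>B. zero_forcing_set G B \<and> card B = n)"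

primrec blue_after :: "'a graph \<Rightarrow> 'a set \<Rightarrow> nat \<Rightarrow> 'a set" where
  "blue_after G B 0 = B"
| "blue_after G B (Suc k) =
     blue_after G B k \<union> {v. \<exists>u. can_force G (blue_after G B k) u v}"

definition propagation_time_of :: "'a graph \<Rightarrow> 'a set \<Rightarrow> nat" where
  "propagation_time_of G B = (LEAST k. blue_after G B k = verts G)"

definition propagation_time :: "'a graph \<Rightarrow> nat" where
  "propagation_time G =
     (LEAST t. \<exists>B. zero_forcing_set G B \<and> card B = zero_forcing_number G \<and>
                   propagation_time_of G B = t)"

text \<open>\<open>Hub i\<close> is the wheel vertex $v_i$ (the center for \<open>i = 0\<close>), and \<open>Pendant i j\<close> is
  the $j$-th pendant vertex $p_{i,j}$ attached to $v_i$.\<close>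

datatype helm_vertex = Hub nat | Pendant nat nat

definition generalized_helm :: "nat \<Rightarrow> nat \<Rightarrow> helm_vertex graph" where
  "generalized_helm m s =
     \<lparr> verts = {Hub i | i. i \<le> m} \<union> {Pendant i j | i j. i \<in> {1..m} \<and> j \<in> {1..s}},
       edges = {{Hub 0, Hub i} | i. i \<in> {1..m}}
             \<union> {{Hub i, Hub i'} | i i'. i \<in> {1..m} \<and> i' \<in> {1..m} \<and>
                  (\<bar>int i - int i'\<bar> = 1 \<or> {i, i'} = {1, m})}
             \<union> {{Hub i, Pendant i j} | i j. i \<in> {1..m} \<and> j \<in> {1..s}} \<rparr>"

lemma finite_simple_graph_generalized_helm:
  assumes "m \<ge> 3"
  shows "finite_simple_graph (generalized_helm m s)"
proof -
  have "verts (generalized_helm m s) =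
          Hub ` {..m} \<union> (\<lambda>(i, j). Pendant i j) ` ({1..m} \<times> {1..s})"
    by (auto simp: generalized_helm_def image_iff)
  then have "finite (verts (generalized_helm m s))" by simp
  moreover have "e \<subseteq> verts (generalized_helm m s) \<and> card e = 2"
    if "e \<in> edges (generalized_helm m s)" for e
  proof -
    from that consider
      (a) i where "e = {Hub 0, Hub i}" "i \<in> {1..m}"
    | (b) i i' where "e = {Hub i, Hub i'}" "i \<in> {1..m}" "i' \<in> {1..m}"
        "\<bar>int i - int i'\<bar> = 1 \<or> {i, i'} = {1, m}"
    | (c) i j where "e = {Hub i, Pendant i j}" "i \<in> {1..m}" "j \<in> {1..s}"
      unfolding generalized_helm_def by auto
    then show ?thesis
    proof cases
      case b
      then have "i \<noteq> i'" using assms by (auto simp: doubleton_eq_iff)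
      then show ?thesis using b by (auto simp: generalized_helm_def)
    qed (auto simp: generalized_helm_def)
  qed
  ultimately show ?thesis unfolding finite_simple_graph_def by blast
qed

end

theory Submission
  imports Defs
begin

text \<open>A nonempty set \<open>W\<close> of vertices is a \<^emph>\<open>fort\<close> if no vertex outside \<open>W\<close> has exactly one
  neighbor in \<open>W\<close>; every zero forcing set meets every fort. Two pendants at the same spoke vertex
  form a fort, so a zero forcing set misses at most one pendant per spoke vertex, and the center
  together with one pendant per spoke vertex is a fort, which accounts for the additional vertex.
  The center and all pendants but one at each spoke vertex force everything in two steps. If one
  step sufficed, then at each spoke vertex either all pendants are blue initially, or the missing
  one is forced by the spoke vertex, which is therefore blue initially. Either way \<open>s\<close> blue
  vertices are needed at each spoke vertex, and \<open>m s\<close> exceeds the zero forcing number.\<close>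

section \<open>Forts as obstructions to zero forcing\<close>

text \<open>As long as all of \<open>W\<close> is white, a force into \<open>W\<close> must come
  from a vertex outside \<open>W\<close>, and its target is then the only neighbor of that vertex in
  \<open>W\<close>. The fort condition excludes this, so \<open>W\<close> stays white
  forever.\<close>

lemma zero_forcing_set_meets_fort:
  assumes B: "zero_forcing_set G B"
    and W: "W \<subseteq> verts G" "W \<noteq> {}"
    and fort: "\<And>u v. u \<notin> W \<Longrightarrow> neighbors G u \<inter> W \<noteq> {v}"
  shows "B \<inter> W \<noteq> {}"
proof
  assume disj: "B \<inter> W = {}"
  have "S \<inter> W = {}" if "(force_step G)\<^sup>*\<^sup>* B S" for S
    using that
  proof (induction rule: rtranclp_induct)
    case base
    show ?case by (fact disj)
  next
    case (step S S')
    from step.hyps(2) obtain u v where uv: "can_force G S u v" "S' = insert v S"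
      by cases
    have "u \<notin> W" using uv(1) step.IH by (auto simp: can_force_def)
    moreover have "neighbors G u \<inter> W = {v}" if "v \<in> W"
      using uv(1) step.IH that unfolding can_force_def by blast
    ultimately have "v \<notin> W" using fort by blast
    then show ?case using uv(2) step.IH by blast
  qed
  then have "verts G \<inter> W = {}" using B unfolding zero_forcing_set_def by blast
  then show False using W by blast
qed

section \<open>Single forces versus simultaneous rounds\<close>

text \<open>The forces of one round can be performed one at a time: turning other vertices blue
  first leaves \<open>v\<close> the only white neighbor of its forcing vertex.\<close>

lemma force_steps_union:
  assumes "finite F" and "\<And>v. v \<in> F \<Longrightarrow> \<exists>u. can_force G S u v"
  shows "(force_step G)\<^sup>*\<^sup>* S (S \<union> F)"
  using assms
proof (induction F rule: finite_induct)
  case empty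
  show ?case by simp
next
  case (insert v F)
  have IH: "(force_step G)\<^sup>*\<^sup>* S (S \<union> F)" using insert by blast
  obtain u where "can_force G S u v" using insert.prems by blast
  then have "can_force G (S \<union> F) u v"
    using insert.hyps(2) unfolding can_force_def by blast
  then have "force_step G (S \<union> F) (insert v (S \<union> F))" by (rule force_step.intros)
  then show ?case using IH by (simp add: rtranclp.rtrancl_into_rtrancl)
qed

lemma blue_after_subset_verts:
  assumes "B \<subseteq> verts G"
  shows "blue_after G B k \<subseteq> verts G"
  using assms by (induction k) (auto simp: can_force_def neighbors_def)

lemma blue_after_mono: "k \<le> l \<Longrightarrow> blue_after G B k \<subseteq> blue_after G B l"
  by (rule lift_Suc_mono_le) auto

lemma force_steps_blue_after:
  assumes "finite (verts G)"
  shows "(force_step G)\<^sup>*\<^sup>* B (blue_after G B k)"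
proof (induction k)
  case 0
  show ?case by simp
next
  case (Suc k)
  let ?F = "{v. \<exists>u. can_force G (blue_after G B k) u v}"
  have "?F \<subseteq> verts G" by (auto simp: can_force_def neighbors_def)
  then have "finite ?F" using assms finite_subset by blast
  then have "(force_step G)\<^sup>*\<^sup>* (blue_after G B k) (blue_after G B k \<union> ?F)"
    by (rule force_steps_union) blast
  then show ?case using Suc by simp
qed

text \<open>Enlarging the blue set never loses a force: either \<open>v\<close> is blue already, or
  \<open>u\<close> can still force it. Hence the simultaneous process catches up with any sequence
  of single forces.\<close>

lemma force_steps_subset_blue_after:
  assumes "(force_step G)\<^sup>*\<^sup>* B S"
  shows "\<exists>k. S \<subseteq> blue_after G B k"
  using assms
proof (induction rule: rtranclp_induct)
  case base
  have "B \<subseteq> blue_after G B 0" by simp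
  then show ?case by blast
next
  case (step S S')
  from step.hyps(2) obtain u v where uv: "can_force G S u v" "S' = insert v S"
    by cases
  obtain k where k: "S \<subseteq> blue_after G B k" using step.IH by blast
  have "v \<in> blue_after G B (Suc k)"
  proof (cases "v \<in> blue_after G B k")
    case False
    then have "can_force G (blue_after G B k) u v"
      using uv(1) k unfolding can_force_def by blast
    then show ?thesis by auto
  qed simp
  then have "S' \<subseteq> blue_after G B (Suc k)" using uv(2) k by auto
  then show ?case by blast
qed

text \<open>Some round colors all vertices, so the \<open>LEAST\<close> defining the propagation
  time is attained.\<close>

lemma blue_after_propagation_time_of:
  assumes "zero_forcing_set G B"
  shows "blue_after G B (propagation_time_of G B) = verts G"
proof -
  have B: "B \<subseteq> verts G" "(force_step G)\<^sup>*\<^sup>* B (verts G)"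
    using assms by (auto simp: zero_forcing_set_def)
  obtain k where "verts G \<subseteq> blue_after G B k"
    using force_steps_subset_blue_after[OF B(2)] by blast
  then have "blue_after G B k = verts G" using blue_after_subset_verts[OF B(1)] by blast
  then show ?thesis unfolding propagation_time_of_def by (rule LeastI)
qed

lemma card_ge_disjoint_family:
  assumes "finite B" and "finite I"
    and "\<And>i. i \<in> I \<Longrightarrow> A i \<subseteq> B"
    and "\<And>i j. i \<in> I \<Longrightarrow> j \<in> I \<Longrightarrow> i \<noteq> j \<Longrightarrow> A i \<inter> A j = {}"
    and "\<And>i. i \<in> I \<Longrightarrow> c \<le> card (A i)"
  shows "card I * c \<le> card B"
proof -
  have "card I * c \<le> (\<Sum>i\<in>I. card (A i))"
    using sum_bounded_below[of I c "\<lambda>i. card (A i)"] assms(5) by simp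
  also have "\<dots> = card (\<Union>i\<in>I. A i)"
    using assms finite_subset by (intro card_UN_disjoint[symmetric]) blast+
  also have "\<dots> \<le> card B"
    using assms by (intro card_mono) blast+
  finally show ?thesis .
qed

section \<open>Vertices and neighborhoods of the helm graph\<close>

lemma verts_helm:
  "verts (generalized_helm m s) =
     Hub ` {..m} \<union> (\<lambda>(i, j). Pendant i j) ` ({1..m} \<times> {1..s})"
  by (auto simp: generalized_helm_def image_iff)

lemma finite_verts_helm: "finite (verts (generalized_helm m s))"
  by (simp add: verts_helm)

lemma card_Pendant_image: "card (Pendant i ` J) = card J"
  by (simp add: card_image inj_on_def)

lemma neighbors_Pendant:
  "neighbors (generalized_helm m s) (Pendant i j) =
     (if i \<in> {1..m} \<and> j \<in> {1..s} then {Hub i} else {})"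
  by (auto simp: neighbors_def generalized_helm_def doubleton_eq_iff)

lemma Pendant_in_neighbors_iff:
  "Pendant i j \<in> neighbors (generalized_helm m s) u \<longleftrightarrow>
     u = Hub i \<and> i \<in> {1..m} \<and> j \<in> {1..s}"
  by (auto simp: neighbors_def generalized_helm_def doubleton_eq_iff)

lemma center_in_neighbors_iff:
  "Hub 0 \<in> neighbors (generalized_helm m s) u \<longleftrightarrow> u \<in> Hub ` {1..m}"
  by (auto simp: neighbors_def generalized_helm_def doubleton_eq_iff)

section \<open>Lower bounds on the number of blue vertices\<close>

lemma zero_forcing_set_helm_pendants:
  assumes B: "zero_forcing_set (generalized_helm m s) B" and i: "i \<in> {1..m}"
  shows "s - 1 \<le> card (B \<inter> Pendant i ` {1..s})"
proof -
  have unique: "j = k"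
    if "j \<in> {1..s}" "k \<in> {1..s}" "Pendant i j \<notin> B" "Pendant i k \<notin> B" for j k
  proof (rule ccontr)
    assume "j \<noteq> k"
    let ?W = "{Pendant i j, Pendant i k}"
    have "B \<inter> ?W \<noteq> {}"
    proof (rule zero_forcing_set_meets_fort[OF B])
      show "?W \<subseteq> verts (generalized_helm m s)" using that i by (auto simp: verts_helm)
      fix u v
      \<comment> \<open>Both pendants have \<open>Hub i\<close> as their only neighbor, so every
        vertex sees both or neither.\<close>
      have "Pendant i j \<in> neighbors (generalized_helm m s) u \<longleftrightarrow>
          Pendant i k \<in> neighbors (generalized_helm m s) u"
        using that by (simp add: Pendant_in_neighbors_iff)
      moreover have "Pendant i j \<noteq> Pendant i k" using \<open>j \<noteq> k\<close> by simp
      ultimately show "neighbors (generalized_helm m s) u \<inter> ?W \<noteq> {v}"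
        by (metis Int_iff insertI1 insert_iff singletonD)
    qed simp
    then show False using that by blast
  qed
  have "card (Pendant i ` {1..s} - B) \<le> Suc 0"
    using unique by (auto simp: card_le_Suc0_iff_eq)
  moreover have "card (Pendant i ` {1..s})
      = card (Pendant i ` {1..s} \<inter> B) + card (Pendant i ` {1..s} - B)"
    by (rule card_Int_Diff) simp
  ultimately show ?thesis by (simp add: card_Pendant_image Int_commute)
qed

lemma zero_forcing_set_helm_center_or_full_row:
  assumes B: "zero_forcing_set (generalized_helm m s) B" and "Hub 0 \<notin> B"
  shows "\<exists>i\<in>{1..m}. Pendant i ` {1..s} \<subseteq> B"
proof (rule ccontr)
  assume "\<not> ?thesis"
  then have "\<forall>i\<in>{1..m}. \<exists>j\<in>{1..s}. Pendant i j \<notin> B" by blast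
  then obtain a where a: "\<And>i. i \<in> {1..m} \<Longrightarrow> a i \<in> {1..s} \<and> Pendant i (a i) \<notin> B"
    by metis
  \<comment> \<open>Each spoke vertex sees exactly two elements of this fort, the center and its own
    chosen white pendant; all other vertices see none.\<close>
  let ?W = "insert (Hub 0) ((\<lambda>i. Pendant i (a i)) ` {1..m})"
  have "B \<inter> ?W \<noteq> {}"
  proof (rule zero_forcing_set_meets_fort[OF B])
    show "?W \<subseteq> verts (generalized_helm m s)" using a by (auto simp: verts_helm)
    fix u v
    show "neighbors (generalized_helm m s) u \<inter> ?W \<noteq> {v}"
    proof (cases "u \<in> Hub ` {1..m}")
      case True
      then obtain i where i: "u = Hub i" "i \<in> {1..m}" by blast
      then have "Hub 0 \<in> neighbors (generalized_helm m s) u"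
        by (simp only: center_in_neighbors_iff) blast
      moreover have "Pendant i (a i) \<in> neighbors (generalized_helm m s) u"
        using a i by (simp add: Pendant_in_neighbors_iff)
      ultimately have "{Hub 0, Pendant i (a i)} \<subseteq> neighbors (generalized_helm m s) u \<inter> ?W"
        using i by blast
      then show ?thesis by auto
    next
      case False
      then have "neighbors (generalized_helm m s) u \<inter> ?W = {}"
        by (auto simp: center_in_neighbors_iff Pendant_in_neighbors_iff)
      then show ?thesis by simp
    qed
  qed simp
  then show False using \<open>Hub 0 \<notin> B\<close> a by blast
qed

lemma zero_forcing_set_helm_card_ge:
  assumes B: "zero_forcing_set (generalized_helm m s) B" and "s \<ge> 1"
  shows "m * (s - 1) + 1 \<le> card B"
proof -
  have fin: "finite B"
    using B finite_verts_helm finite_subset unfolding zero_forcing_set_def by blast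
  \<comment> \<open>The vertex \<open>x\<close> is the surplus one: the center if it is blue,
    otherwise a pendant from a completely blue row, which can spare one of its \<open>s\<close>
    elements.\<close>
  have "\<exists>x\<in>B. \<forall>i\<in>{1..m}. s - 1 \<le> card ((B - {x}) \<inter> Pendant i ` {1..s})"
  proof (cases "Hub 0 \<in> B")
    case True
    have "(B - {Hub 0}) \<inter> Pendant i ` {1..s} = B \<inter> Pendant i ` {1..s}" for i by auto
    then show ?thesis using True zero_forcing_set_helm_pendants[OF B] by (intro bexI[of _ "Hub 0"]) simp_all
  next
    case False
    then obtain i where i: "i \<in> {1..m}" "Pendant i ` {1..s} \<subseteq> B"
      using zero_forcing_set_helm_center_or_full_row[OF B] by blast
    have "s - 1 \<le> card ((B - {Pendant i 1}) \<inter> Pendant k ` {1..s})" if k: "k \<in> {1..m}" for k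
    proof (cases "k = i")
      case True
      have "(B - {Pendant i 1}) \<inter> Pendant i ` {1..s} = Pendant i ` {1..s} - {Pendant i 1}"
        using i by blast
      moreover have "Pendant i 1 \<in> Pendant i ` {1..s}" using \<open>s \<ge> 1\<close> by simp
      ultimately show ?thesis using True by (simp add: card_Pendant_image)
    next
      case False
      then have "(B - {Pendant i 1}) \<inter> Pendant k ` {1..s} = B \<inter> Pendant k ` {1..s}" by auto
      then show ?thesis using zero_forcing_set_helm_pendants[OF B k] by simp
    qed
    moreover have "Pendant i 1 \<in> B" using i \<open>s \<ge> 1\<close> by auto
    ultimately show ?thesis by blast
  qed
  then obtain x where x: "x \<in> B"
    "\<And>i. i \<in> {1..m} \<Longrightarrow> s - 1 \<le> card ((B - {x}) \<inter> Pendant i ` {1..s})" by blast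
  have "card {1..m} * (s - 1) \<le> card (B - {x})"
    by (rule card_ge_disjoint_family[where A = "\<lambda>i. (B - {x}) \<inter> Pendant i ` {1..s}"])
      (use fin x(2) in auto)
  moreover have "card B = Suc (card (B - {x}))"
    using fin x(1) by (rule card.remove)
  ultimately show ?thesis by simp
qed

lemma helm_one_step_card_ge:
  assumes B: "zero_forcing_set (generalized_helm m s) B"
    and step: "blue_after (generalized_helm m s) B 1 = verts (generalized_helm m s)"
    and "s \<ge> 1"
  shows "m * s \<le> card B"
proof -
  \<comment> \<open>Putting the spoke vertex together with its pendants keeps these sets disjoint
    and lets a blue \<open>Hub i\<close> make up for the one pendant that may be missing.\<close>
  let ?A = "\<lambda>i. B \<inter> insert (Hub i) (Pendant i ` {1..s})"
  have fin: "finite B"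
    using B finite_verts_helm finite_subset unfolding zero_forcing_set_def by blast
  have "s \<le> card (?A i)" if i: "i \<in> {1..m}" for i
  proof (cases "Hub i \<in> B")
    case True
    then have "?A i = insert (Hub i) (B \<inter> Pendant i ` {1..s})" by blast
    then have "card (?A i) = Suc (card (B \<inter> Pendant i ` {1..s}))"
      using fin by (simp add: image_iff)
    then show ?thesis using zero_forcing_set_helm_pendants[OF B i] by simp
  next
    case False
    have "Pendant i j \<in> B" if "j \<in> {1..s}" for j
    proof (rule ccontr)
      assume "Pendant i j \<notin> B"
      moreover have "Pendant i j \<in> blue_after (generalized_helm m s) B 1"
        unfolding step verts_helm using i that by auto
      ultimately obtain u where "can_force (generalized_helm m s) B u (Pendant i j)"
        by auto
      then have "u \<in> B" "Pendant i j \<in> neighbors (generalized_helm m s) u"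
        by (auto simp: can_force_def)
      then show False using False by (simp add: Pendant_in_neighbors_iff)
    qed
    then have "Pendant i ` {1..s} \<subseteq> ?A i" by blast
    then have "card (Pendant i ` {1..s}) \<le> card (?A i)" using fin by (intro card_mono) auto
    then show ?thesis by (simp add: card_Pendant_image)
  qed
  then have "card {1..m} * s \<le> card B"
    by (intro card_ge_disjoint_family[where A = ?A]) (use fin in auto)
  then show ?thesis by simp
qed

section \<open>A minimum forcing set that finishes in two rounds\<close>

text \<open>The pendant left out at each spoke vertex is the one with index 1.\<close>

definition helm_forcing_set :: "nat \<Rightarrow> nat \<Rightarrow> helm_vertex set" where
  "helm_forcing_set m s = insert (Hub 0) ((\<lambda>(i, j). Pendant i j) ` ({1..m} \<times> {2..s}))"

lemma helm_forcing_set_subset_verts: "helm_forcing_set m s \<subseteq> verts (generalized_helm m s)"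
  by (auto simp: helm_forcing_set_def verts_helm)

lemma card_helm_forcing_set: "card (helm_forcing_set m s) = m * (s - 1) + 1"
proof -
  have "inj_on (\<lambda>(i, j). Pendant i j) ({1..m} \<times> {2..s})" by (auto simp: inj_on_def)
  moreover have "Hub 0 \<notin> (\<lambda>(i, j). Pendant i j) ` ({1..m} \<times> {2..s})" by auto
  ultimately show ?thesis
    by (simp add: helm_forcing_set_def card_image card_cartesian_product)
qed

lemma blue_after_helm_forcing_set:
  assumes "s > 1"
  shows "blue_after (generalized_helm m s) (helm_forcing_set m s) 2
       = verts (generalized_helm m s)"
proof -
  let ?G = "generalized_helm m s" and ?B = "helm_forcing_set m s"
  have hub: "Hub i \<in> blue_after ?G ?B 1" if "i \<le> m" for i
  proof (cases "i = 0")
    case True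
    then show ?thesis by (simp add: helm_forcing_set_def)
  next
    case False
    \<comment> \<open>\<open>Pendant i 2\<close> exists and is blue because \<open>s > 1\<close>,
      and its only neighbor is the white \<open>Hub i\<close>.\<close>
    then have "can_force ?G ?B (Pendant i 2) (Hub i)"
      using that assms unfolding can_force_def neighbors_Pendant
      by (auto simp: helm_forcing_set_def)
    then show ?thesis by auto
  qed
  have pendant: "Pendant i j \<in> blue_after ?G ?B 2" if ij: "i \<in> {1..m}" "j \<in> {1..s}" for i j
  proof (cases "Pendant i j \<in> blue_after ?G ?B 1")
    case True
    then show ?thesis using blue_after_mono[of 1 2 ?G ?B] by auto
  next
    case False
    have blue: "Pendant i k \<in> blue_after ?G ?B 1" if "k \<in> {2..s}" for k
      using ij that by (auto simp: helm_forcing_set_def)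
    \<comment> \<open>After one round the center, all spoke vertices and all pendants of index at
      least 2 are blue, so a white neighbor of \<open>Hub i\<close> is a pendant of index 1, and
      \<open>j\<close> is 1 as well.\<close>
    have "x = Pendant i j" if x: "x \<in> neighbors ?G (Hub i)" "x \<notin> blue_after ?G ?B 1" for x
    proof (cases x)
      case (Hub k)
      then have "k \<le> m" using x(1) by (auto simp: neighbors_def verts_helm)
      then show ?thesis using hub Hub x(2) by blast
    next
      case (Pendant i' k)
      then have k: "i' = i" "k \<in> {1..s}" using x(1) by (auto simp: Pendant_in_neighbors_iff)
      have "k \<notin> {2..s}" using blue Pendant k(1) x(2) by blast
      moreover have "j \<notin> {2..s}" using blue False by blast
      ultimately have "k = j" using k(2) ij(2) by auto
      then show ?thesis using Pendant k(1) by simp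
    qed
    moreover have "Pendant i j \<in> neighbors ?G (Hub i)"
      using ij by (simp add: Pendant_in_neighbors_iff)
    ultimately have "neighbors ?G (Hub i) - blue_after ?G ?B 1 = {Pendant i j}"
      using False by blast
    moreover have "Hub i \<in> blue_after ?G ?B 1" using hub ij(1) by simp
    ultimately have "can_force ?G (blue_after ?G ?B 1) (Hub i) (Pendant i j)"
      unfolding can_force_def by blast
    then have "Pendant i j \<in> blue_after ?G ?B (Suc 1)"
      unfolding blue_after.simps(2)[of ?G ?B 1] by blast
    then show ?thesis by (simp only: Suc_1)
  qed
  have "Hub i \<in> blue_after ?G ?B 2" if "i \<le> m" for i
    using hub[OF that] blue_after_mono[of 1 2 ?G ?B] by (meson one_le_numeral subsetD)
  then have "verts ?G \<subseteq> blue_after ?G ?B 2"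
    using pendant by (auto simp: verts_helm)
  then show ?thesis
    using blue_after_subset_verts[OF helm_forcing_set_subset_verts] by blast
qed

lemma zero_forcing_set_helm_forcing_set:
  assumes "s > 1"
  shows "zero_forcing_set (generalized_helm m s) (helm_forcing_set m s)"
  using force_steps_blue_after[OF finite_verts_helm, of m s "helm_forcing_set m s" 2]
    helm_forcing_set_subset_verts
  by (simp add: zero_forcing_set_def blue_after_helm_forcing_set[OF assms])

theorem theorem3p10:
  fixes m s :: nat
  assumes "m \<ge> 3" and "s > 1"
  shows "zero_forcing_number (generalized_helm m s) = m * (s - 1) + 1
       \<and> propagation_time (generalized_helm m s) = 2"
proof
  let ?G = "generalized_helm m s" and ?B = "helm_forcing_set m s"
  have B: "zero_forcing_set ?G ?B" "card ?B = m * (s - 1) + 1"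
    using zero_forcing_set_helm_forcing_set[OF assms(2)] card_helm_forcing_set by auto
  show Z: "zero_forcing_number ?G = m * (s - 1) + 1"
    unfolding zero_forcing_number_def
  proof (rule Least_equality)
    show "\<exists>B. zero_forcing_set ?G B \<and> card B = m * (s - 1) + 1" using B by blast
  qed (use zero_forcing_set_helm_card_ge assms in force)
  have ge: "2 \<le> propagation_time_of ?G C"
    if C: "zero_forcing_set ?G C" "card C = zero_forcing_number ?G" for C
  proof (rule ccontr)
    assume "\<not> ?thesis"
    \<comment> \<open>Monotonicity treats propagation times 0 and 1 together.\<close>
    then have "verts ?G \<subseteq> blue_after ?G C 1"
      using blue_after_mono[of "propagation_time_of ?G C" 1 ?G C]
        blue_after_propagation_time_of[OF C(1)] by simp
    then have "blue_after ?G C 1 = verts ?G"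
      using C(1) blue_after_subset_verts unfolding zero_forcing_set_def by blast
    then have "m * s \<le> m * (s - 1) + 1"
      using helm_one_step_card_ge[OF C(1)] C(2) Z assms by simp
    \<comment> \<open>Comparing with the previous inequality gives \<open>m \<le> 1\<close>, against
      \<open>m \<ge> 3\<close>.\<close>
    moreover have "m * s = m * (s - 1) + m" using assms by (cases s) auto
    ultimately show False using assms by simp
  qed
  have "propagation_time_of ?G ?B \<le> 2"
    unfolding propagation_time_of_def
    by (rule Least_le) (rule blue_after_helm_forcing_set[OF assms(2)])
  then have "propagation_time_of ?G ?B = 2" using ge B Z by (simp add: le_antisym)
  then show "propagation_time ?G = 2"
    unfolding propagation_time_def
    using B Z ge by (intro Least_equality) auto
qed

end
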